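(* The Diophantine equation $L_n^\alpha + L_{n+1}^\alpha = x^2$ with $n=0$ has exactly one solution in non-negative integers, namely $(n,\alpha,x)=(0,3,3)$. Equivalently, for non-negative integers $\alpha, x$, one has $L_0^\alpha + L_1^\alpha = x^2$ if and only if $(\alpha,x)=(3,3)$.
   Context: The Lucas sequence $(L_n)_{n\ge 0}$ is defined by $L_0=2$, $L_1=1$, and $L_{n+2}=L_{n+1}+L_n$ for all $n\ge 0$. *)

theory Defs
  imports Main
begin

fun lucas :: "nat \<Rightarrow> nat" where
  "lucas 0 = 2"
| "lucas (Suc 0) = 1"
| "lucas (Suc (Suc n)) = lucas (Suc n) + lucas n"

end

theory Submission
  imports Defs "HOL-Computational_Algebra.Primes"
begin

text \<open>Since the two Lucas numbers involved are 2 and 1, the equation reads 2^\<alpha> + 1 =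
  x^2, that is, 2^\<alpha> = (x - 1)(x + 1). Both factors are then powers of 2, and they differ by
  2. By \<open>two_powers_differing_by_two\<close> they must be 2 and 4, so x = 3 and 2^\<alpha> =
  8.\<close>

lemma two_powers_differing_by_two:
  fixes i j :: nat
  assumes "2 ^ i + 2 = (2 ^ j :: nat)"
  shows "i = 1 \<and> j = 2"
proof -
  have "\<not> j \<le> 1"
  proof
    assume "j \<le> 1"
    hence "j = 0 \<or> j = 1" by auto
    thus False using assms by auto
  qed
  then obtain k where j: "j = k + 2"
    by (metis add.commute le_Suc_ex not_less_eq_eq numeral_2_eq_2 One_nat_def)
  \<comment> \<open>Now 4 divides \<open>2 ^ j\<close>, so \<open>2 ^ i\<close> is 2 modulo 4. But
    \<open>i = 0\<close> makes the left-hand side 3, and \<open>i = l + 2\<close> makes it 2 modulo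
    4.\<close>
  have i: "i = 1"
  proof (rule ccontr)
    assume "i \<noteq> 1"
    then consider "i = 0" | l where "i = l + 2"
      by (metis One_nat_def add_2_eq_Suc' not0_implies_Suc)
    thus False
    proof cases
      case 1
      thus False using assms j by (simp, presburger)
    next
      case 2
      thus False using assms j by (simp, presburger)
    qed
  qed
  have "(2::nat) ^ j = 2 ^ 2" using assms i by simp
  hence "j = 2" by (subst (asm) power_inject_exp) auto
  with i show ?thesis by simp
qed

lemma two_power_plus_one_eq_square_iff:
  fixes a x :: nat
  shows "2 ^ a + 1 = x ^ 2 \<longleftrightarrow> a = 3 \<and> x = 3"
proof
  assume eq: "2 ^ a + 1 = x ^ 2"
  \<comment> \<open>Positivity of \<open>x\<close> lets \<open>y\<close> stand for x - 1 without
    truncated subtraction.\<close>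
  have "x \<noteq> 0" using eq by (cases "x = 0") auto
  then obtain y where x: "x = y + 1" by (metis Suc_eq_plus1 not0_implies_Suc)
  have fac: "2 ^ a = y * (y + 2)"
    using eq by (simp add: x power2_eq_square)
  \<comment> \<open>A divisor of a power of the prime 2 is itself a power of 2; this applies to both
    factors.\<close>
  obtain i where i: "y = 2 ^ i"
    using fac divides_primepow_nat[OF two_is_prime_nat] by (metis dvd_triv_left)
  obtain j where j: "y + 2 = 2 ^ j"
    using fac divides_primepow_nat[OF two_is_prime_nat] by (metis dvd_triv_right)
  have "i = 1" using two_powers_differing_by_two i j by simp
  hence "y = 2" using i by simp
  hence "(2::nat) ^ a = 2 ^ 3" using fac by simp
  hence "a = 3" by (subst (asm) power_inject_exp) auto
  with \<open>y = 2\<close> x show "a = 3 \<and> x = 3" by simp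
qed auto

theorem proposition3p4:
  shows "{(n :: nat, \<alpha> :: nat, x :: nat).
            n = 0 \<and> lucas n ^ \<alpha> + lucas (n + 1) ^ \<alpha> = x ^ 2} = {(0, 3, 3)}
       \<and> (\<forall>(\<alpha> :: nat) (x :: nat).
            lucas 0 ^ \<alpha> + lucas 1 ^ \<alpha> = x ^ 2 \<longleftrightarrow> (\<alpha>, x) = (3, 3))"
proof -
  have "lucas 0 ^ a + lucas 1 ^ a = x ^ 2 \<longleftrightarrow> a = 3 \<and> x = 3" for a x :: nat
    using two_power_plus_one_eq_square_iff[of a x] by simp
  thus ?thesis by auto
qed

end
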